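(* Let $s,t$ be integers with $2\le s\le t-2$ and $t\ge 34$. Then $R^4(BK_t,BK_s)=t$.
   Context: For a graph $G=(V,E)$ and an integer $r\ge 2$, $BG$ (the set of Berge copies of $G$) is the set of $r$-uniform hypergraphs $\mathcal{H}'$ for which there exist an injection $\phi: V\to V(\mathcal{H}')$ and a bijection $\psi: E\to E(\mathcal{H}')$ such that $\{\phi(u),\phi(v)\}\subseteq \psi(uv)$ for every edge $uv\in E$. $K_n$ denotes the complete graph on $n$ vertices. For collections $\mathcal{F}_1,\mathcal{F}_2$ of $r$-uniform hypergraphs, $R^r(\mathcal{F}_1,\mathcal{F}_2)$ is the least $N$ such that every 2-coloring of the hyperedges of the complete $r$-uniform hypergraph on $N$ vertices contains a subhypergraph of the first color isomorphic to a member of $\mathcal{F}_1$ or one of the second color isomorphic to a member of $\mathcal{F}_2$. Here $r=4$. *)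

theory Defs
  imports "HOL-Library.Ramsey"
begin

type_synonym 'a hypergraph = "'a set \<times> 'a set set"

abbreviation verts :: "'a hypergraph \<Rightarrow> 'a set" where
  "verts H \<equiv> fst H"

abbreviation hedges :: "'a hypergraph \<Rightarrow> 'a set set" where
  "hedges H \<equiv> snd H"

text \<open>A graph is a \<open>2\<close>-uniform hypergraph. Isolated vertices are allowed.\<close>

definition uniform_hypergraph :: "nat \<Rightarrow> 'a hypergraph \<Rightarrow> bool" where
  "uniform_hypergraph r H \<longleftrightarrow> finite (verts H) \<and> hedges H \<subseteq> [verts H]\<^bsup>r\<^esup>"

definition complete_hypergraph :: "nat \<Rightarrow> nat \<Rightarrow> nat hypergraph" where
  "complete_hypergraph r n = ({..<n}, [{..<n}]\<^bsup>r\<^esup>)"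

abbreviation complete_graph :: "nat \<Rightarrow> nat hypergraph" where
  "complete_graph n \<equiv> complete_hypergraph 2 n"

definition subhypergraph :: "'a hypergraph \<Rightarrow> 'a hypergraph \<Rightarrow> bool" where
  "subhypergraph H K \<longleftrightarrow>
     verts H \<subseteq> verts K \<and> hedges H \<subseteq> hedges K \<and> (\<forall>e\<in>hedges H. e \<subseteq> verts H)"

definition hypergraph_iso :: "'a hypergraph \<Rightarrow> 'b hypergraph \<Rightarrow> bool" where
  "hypergraph_iso H K \<longleftrightarrow>
     (\<exists>f. bij_betw f (verts H) (verts K) \<and> (\<lambda>e. f ` e) ` hedges H = hedges K)"

text \<open>The \<open>r\<close>-uniform Berge copies of \<open>G\<close> whose vertices are taken from the type \<open>'b\<close>.\<close>

definition Berge :: "nat \<Rightarrow> 'a hypergraph \<Rightarrow> 'b hypergraph set" where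
  "Berge r G = {H. uniform_hypergraph r H \<and>
     (\<exists>\<phi> \<psi>. inj_on \<phi> (verts G) \<and> \<phi> ` verts G \<subseteq> verts H \<and>
            bij_betw \<psi> (hedges G) (hedges H) \<and>
            (\<forall>u v. {u, v} \<in> hedges G \<longrightarrow> {\<phi> u, \<phi> v} \<subseteq> \<psi> {u, v}))}"

definition color_class :: "'a hypergraph \<Rightarrow> ('a set \<Rightarrow> nat) \<Rightarrow> nat \<Rightarrow> 'a hypergraph" where
  "color_class H c i = (verts H, {e \<in> hedges H. c e = i})"

definition contains_member :: "'a hypergraph \<Rightarrow> 'b hypergraph set \<Rightarrow> bool" where
  "contains_member H \<F> \<longleftrightarrow> (\<exists>H' F. subhypergraph H' H \<and> F \<in> \<F> \<and> hypergraph_iso H' F)"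

definition ramsey_property ::
    "nat \<Rightarrow> 'a hypergraph set \<Rightarrow> 'b hypergraph set \<Rightarrow> nat \<Rightarrow> bool" where
  "ramsey_property r \<F>\<^sub>1 \<F>\<^sub>2 N \<longleftrightarrow>
     (\<forall>c \<in> hedges (complete_hypergraph r N) \<rightarrow> {1, 2}.
        contains_member (color_class (complete_hypergraph r N) c 1) \<F>\<^sub>1 \<or>
        contains_member (color_class (complete_hypergraph r N) c 2) \<F>\<^sub>2)"

definition ramsey_number :: "nat \<Rightarrow> 'a hypergraph set \<Rightarrow> 'b hypergraph set \<Rightarrow> nat" where
  "ramsey_number r \<F>\<^sub>1 \<F>\<^sub>2 = (LEAST N. ramsey_property r \<F>\<^sub>1 \<F>\<^sub>2 N)"

end

theory Submission
  imports Defs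
begin

text \<open>
  Let \<open>P\<close> be the set of pairs lying in at most five blue edges. For a pair \<open>q\<close>, the map
  \<open>z \<mapsto> z \<union> q\<close> is a blue Berge clique on \<open>V - q\<close> up to those \<open>z\<close> with \<open>z \<union> q\<close> red; since a
  4-set has six pairs, Hall's theorem repairs these as soon as each of them lies in six blue edges.
  So without a blue \<open>BK\<^bsub>t-2\<^esub>\<close> every pair \<open>q\<close> has a disjoint \<open>p \<in> P\<close> with \<open>q \<union> p\<close> red, and in
  particular \<open>P\<close> has two disjoint members. A weighted form of Hall's theorem then
  gives a red \<open>BK\<^bsub>t\<^esub>\<close>: pairs disjoint from all of \<open>P\<close> are mapped to red edges \<open>q \<union> p\<close>, which
  determine \<open>q\<close>, while a pair meeting some \<open>p \<in> P\<close> lies with \<open>p\<close> in many red edges.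
\<close>

section \<open>Hall's theorem and a weighted form of it\<close>

text \<open>Halmos-Vaughan induction. If some nonempty proper \<open>J\<close> is tight, match
  \<open>J\<close> first and the rest outside its neighbourhood \<open>U\<close>; otherwise every
  nonempty proper subfamily has an element to spare, so any \<open>x\<close> in \<open>A i\<close>
  may be given to \<open>i\<close>.\<close>

lemma hall_marriage:
  fixes A :: "'i \<Rightarrow> 'a set"
  assumes "finite I" and "\<And>i. i \<in> I \<Longrightarrow> finite (A i)"
    and "\<And>J. J \<subseteq> I \<Longrightarrow> card J \<le> card (\<Union>(A ` J))"
  shows "\<exists>g. inj_on g I \<and> (\<forall>i\<in>I. g i \<in> A i)"
  using assms
proof (induction "card I" arbitrary: I A rule: less_induct)
  case less
  note fin = less.prems(1) and finA = less.prems(2) and hall = less.prems(3)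
  show ?case
  proof (cases "\<exists>J. J \<subset> I \<and> J \<noteq> {} \<and> card (\<Union>(A ` J)) \<le> card J")
    case True
    then obtain J where J: "J \<subset> I" "J \<noteq> {}" "card (\<Union>(A ` J)) \<le> card J" by blast
    have finJ: "finite J" using J fin by (meson finite_subset psubset_imp_subset)
    have "\<exists>g. inj_on g J \<and> (\<forall>i\<in>J. g i \<in> A i)"
      using J fin finA hall by (intro less.hyps psubset_card_mono finJ) auto
    then obtain g where g: "inj_on g J" "\<And>i. i \<in> J \<Longrightarrow> g i \<in> A i" by blast
    define U where "U = \<Union>(A ` J)"
    have "\<exists>h. inj_on h (I - J) \<and> (\<forall>i\<in>I - J. h i \<in> A i - U)"
    proof (rule less.hyps)
      show "card (I - J) < card I" using J fin by (intro psubset_card_mono) auto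
      \<comment> \<open>Hall's condition for \<open>K \<union> J\<close>, minus the tight
        contribution of \<open>J\<close>, leaves enough elements outside \<open>U\<close>.\<close>
      show "card K \<le> card (\<Union>i\<in>K. A i - U)" if K: "K \<subseteq> I - J" for K
      proof -
        have finK: "finite K" using K fin by (meson finite_Diff finite_subset)
        have "card K + card J = card (K \<union> J)"
          using K by (intro card_Un_disjoint[symmetric] finK finJ) auto
        also have "\<dots> \<le> card (\<Union>(A ` (K \<union> J)))" using K J by (intro hall) auto
        also have "\<Union>(A ` (K \<union> J)) = (\<Union>i\<in>K. A i - U) \<union> U" by (auto simp: U_def)
        also have "card \<dots> \<le> card (\<Union>i\<in>K. A i - U) + card U" by (rule card_Un_le)
        finally show ?thesis using J(3) by (simp add: U_def)
      qed
    qed (use fin finA in auto)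
    then obtain h where h: "inj_on h (I - J)" "\<And>i. i \<in> I - J \<Longrightarrow> h i \<in> A i - U" by blast
    have gU: "g i \<in> U" if "i \<in> J" for i using g(2) that by (auto simp: U_def)
    define k where "k i = (if i \<in> J then g i else h i)" for i
    have "inj_on k I"
    proof (rule inj_onI)
      fix i j assume ij: "i \<in> I" "j \<in> I" "k i = k j"
      show "i = j"
        using ij g(1) h gU unfolding k_def inj_on_def by (smt (verit) DiffE DiffI)
    qed
    moreover have "\<forall>i\<in>I. k i \<in> A i" using g(2) h(2) by (auto simp: k_def)
    ultimately show ?thesis by blast
  next
    case False
    show ?thesis
    proof (cases "I = {}")
      case True
      then show ?thesis by simp
    next
      case ne: False
      then obtain i where i: "i \<in> I" by blast
      have "card {i} \<le> card (\<Union>(A ` {i}))" using i by (intro hall) auto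
      then have "A i \<noteq> {}" by auto
      then obtain x where x: "x \<in> A i" by blast
      have "\<exists>g. inj_on g (I - {i}) \<and> (\<forall>j\<in>I - {i}. g j \<in> A j - {x})"
      proof (rule less.hyps)
        show "card (I - {i}) < card I" using i fin by (meson card_Diff1_less)
        show "card K \<le> card (\<Union>j\<in>K. A j - {x})" if K: "K \<subseteq> I - {i}" for K
        proof (cases "K = {}")
          case K_ne: False
          have "K \<subset> I" using K i by auto
          then have "card K < card (\<Union>(A ` K))" using False K_ne by (meson not_le)
          moreover have "(\<Union>j\<in>K. A j - {x}) = \<Union>(A ` K) - {x}" by auto
          ultimately show ?thesis by (auto simp: card_Diff_singleton_if)
        qed simp
      qed (use fin finA in auto)
      then obtain g where g: "inj_on g (I - {i})" "\<And>j. j \<in> I - {i} \<Longrightarrow> g j \<in> A j - {x}"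
        by blast
      have "inj_on (g(i := x)) I"
        using g by (auto simp: inj_on_def)
      moreover have "\<forall>j\<in>I. (g(i := x)) j \<in> A j" using g(2) x by auto
      ultimately show ?thesis by blast
    qed
  qed
qed

text \<open>Double counting: let each \<open>i\<close> collect \<open>w i\<close> from every
  candidate. A subfamily \<open>J\<close> then collects at least \<open>D * card J\<close>, while
  each element of its union pays at most \<open>D\<close>; cancelling \<open>D\<close> gives Hall's
  condition.\<close>

lemma weighted_hall:
  fixes A :: "'i \<Rightarrow> 'a set" and w :: "'i \<Rightarrow> nat"
  assumes fin: "finite I" and finA: "\<And>i. i \<in> I \<Longrightarrow> finite (A i)" and D: "D > 0"
    and demand: "\<And>i. i \<in> I \<Longrightarrow> D \<le> w i * card (A i)"
    and capacity: "\<And>e. (\<Sum>i\<in>{i \<in> I. e \<in> A i}. w i) \<le> D"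
  shows "\<exists>g. inj_on g I \<and> (\<forall>i\<in>I. g i \<in> A i)"
proof (rule hall_marriage[OF fin finA])
  fix J assume J: "J \<subseteq> I"
  define U where "U = \<Union>(A ` J)"
  have finJ: "finite J" using J fin by (rule finite_subset)
  have finU: "finite U" using finJ finA J by (auto simp: U_def)
  have "D * card J = (\<Sum>i\<in>J. D)" by simp
  also have "\<dots> \<le> (\<Sum>i\<in>J. w i * card (A i))" using demand J by (intro sum_mono) auto
  also have "\<dots> = (\<Sum>i\<in>J. \<Sum>e\<in>{e \<in> U. e \<in> A i}. w i)"
  proof (rule sum.cong[OF refl])
    fix i assume "i \<in> J"
    then have "{e \<in> U. e \<in> A i} = A i" by (auto simp: U_def)
    then show "w i * card (A i) = (\<Sum>e\<in>{e \<in> U. e \<in> A i}. w i)" by simp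
  qed
  also have "\<dots> = (\<Sum>e\<in>U. \<Sum>i\<in>{i \<in> J. e \<in> A i}. w i)"
    by (rule sum.swap_restrict[OF finJ finU])
  also have "\<dots> \<le> (\<Sum>e\<in>U. D)"
  proof (rule sum_mono)
    fix e
    have "(\<Sum>i\<in>{i \<in> J. e \<in> A i}. w i) \<le> (\<Sum>i\<in>{i \<in> I. e \<in> A i}. w i)"
      using J fin by (intro sum_mono2) auto
    then show "(\<Sum>i\<in>{i \<in> J. e \<in> A i}. w i) \<le> D" using capacity[of e] by linarith
  qed
  also have "\<dots> = D * card U" by simp
  finally show "card J \<le> card (\<Union>(A ` J))" using D by (simp add: U_def)
qed auto

section \<open>Berge cliques and blue cliques from large codegrees\<close>

lemma card_pairs_of_4_set: "card e = 4 \<Longrightarrow> card ([e]\<^bsup>2\<^esup>) = 6"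
  by (simp add: choose_two)

text \<open>\<open>C\<close> is only the core, fixed in place inside the host: the edges
  \<open>g z\<close> may leave \<open>C\<close>, and \<open>E\<close> may contain further
  edges.\<close>

definition berge_clique :: "'a set set \<Rightarrow> 'a set \<Rightarrow> bool" where
  "berge_clique E C \<longleftrightarrow> (\<exists>g. inj_on g ([C]\<^bsup>2\<^esup>) \<and> (\<forall>z\<in>[C]\<^bsup>2\<^esup>. g z \<in> E \<and> z \<subseteq> g z))"

lemma berge_clique_mono: "berge_clique E C \<Longrightarrow> C' \<subseteq> C \<Longrightarrow> berge_clique E C'"
  unfolding berge_clique_def by (meson inj_on_subset nsets_mono subsetD)

text \<open>With unit weights, every pair has at least six candidates and every 4-set is a candidate
  for at most its six pairs.\<close>

lemma sdr_if_codegree_ge_6: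
  assumes V: "finite V" and E: "E \<subseteq> [V]\<^bsup>4\<^esup>" and Z: "Z \<subseteq> [V]\<^bsup>2\<^esup>"
    and deg: "\<And>z. z \<in> Z \<Longrightarrow> 6 \<le> card {e \<in> E. z \<subseteq> e}"
  shows "\<exists>g. inj_on g Z \<and> (\<forall>z\<in>Z. g z \<in> {e \<in> E. z \<subseteq> e})"
proof (rule weighted_hall[where D = 6 and w = "\<lambda>_. 1"])
  have "finite E" using V E by (meson finite_imp_finite_nsets finite_subset)
  then show "finite {e \<in> E. z \<subseteq> e}" for z by simp
  show "finite Z" using V Z by (meson finite_imp_finite_nsets finite_subset)
  show "(\<Sum>z\<in>{z \<in> Z. e \<in> {e \<in> E. z \<subseteq> e}}. 1) \<le> (6::nat)" for e
  proof (cases "e \<in> E")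
    case True
    then have e: "finite e" "card e = 4" using E by (auto simp: nsets_def)
    have "{z \<in> Z. e \<in> {e \<in> E. z \<subseteq> e}} \<subseteq> [e]\<^bsup>2\<^esup>" using Z by (auto simp: nsets_def)
    then have "card {z \<in> Z. e \<in> {e \<in> E. z \<subseteq> e}} \<le> 6"
      using card_mono[OF finite_imp_finite_nsets[OF e(1)]] card_pairs_of_4_set[OF e(2)] by metis
    then show ?thesis by simp
  qed simp
qed (use deg in auto)

text \<open>Only the pairs \<open>z\<close> with \<open>z \<union> q\<close> not in \<open>B\<close>
  need repair, and their new edges come from Hall's theorem. The two kinds of edges cannot collide:
  a \<open>z\<close> that avoids \<open>q\<close> and lies in \<open>z' \<union> q\<close> must
  equal \<open>z'\<close>.\<close>

lemma blue_clique_off_pair: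
  assumes V: "finite V" and B: "B \<subseteq> [V]\<^bsup>4\<^esup>" and q: "q \<subseteq> V"
    and deg: "\<And>z. z \<in> [V - q]\<^bsup>2\<^esup> \<Longrightarrow> z \<union> q \<notin> B \<Longrightarrow> 6 \<le> card {e \<in> B. z \<subseteq> e}"
  shows "berge_clique B (V - q)"
proof -
  define Z where "Z = {z \<in> [V - q]\<^bsup>2\<^esup>. z \<union> q \<notin> B}"
  have "Z \<subseteq> [V]\<^bsup>2\<^esup>" by (auto simp: Z_def nsets_def)
  then have "\<exists>h. inj_on h Z \<and> (\<forall>z\<in>Z. h z \<in> {e \<in> B. z \<subseteq> e})"
    by (rule sdr_if_codegree_ge_6[OF V B]) (use deg in \<open>simp add: Z_def\<close>)
  then obtain h where h: "inj_on h Z" "\<And>z. z \<in> Z \<Longrightarrow> h z \<in> B \<and> z \<subseteq> h z" by blast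
  define g where "g z = (if z \<in> Z then h z else z \<union> q)" for z
  have no_clash: "h z \<noteq> z' \<union> q" if "z \<in> Z" "z' \<in> [V - q]\<^bsup>2\<^esup>" "z' \<notin> Z" for z z'
  proof
    assume "h z = z' \<union> q"
    then have "z \<subseteq> z' \<union> q" using h(2) that(1) by metis
    then have "z \<subseteq> z'" using that by (auto simp: Z_def nsets_def)
    then have "z = z'" using that by (simp add: Z_def nsets_def card_subset_eq)
    then show False using that by simp
  qed
  have "inj_on g ([V - q]\<^bsup>2\<^esup>)"
  proof (rule inj_onI)
    fix z z' assume zz: "z \<in> [V - q]\<^bsup>2\<^esup>" "z' \<in> [V - q]\<^bsup>2\<^esup>" "g z = g z'"
    consider "z \<in> Z" "z' \<in> Z" | "z \<notin> Z" "z' \<notin> Z" | "z \<in> Z" "z' \<notin> Z" | "z \<notin> Z" "z' \<in> Z"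
      by blast
    then show "z = z'"
    proof cases
      case 1
      then show ?thesis using zz(3) h(1) by (simp add: g_def inj_on_eq_iff)
    next
      case 2
      then have "z \<union> q = z' \<union> q" using zz(3) by (simp add: g_def)
      moreover have "z \<inter> q = {}" "z' \<inter> q = {}" using zz by (auto simp: nsets_def)
      ultimately show ?thesis by blast
    next
      case 3
      then show ?thesis using no_clash zz by (simp add: g_def)
    next
      case 4
      then show ?thesis using no_clash zz by (metis g_def)
    qed
  qed
  moreover have "g z \<in> B \<and> z \<subseteq> g z" if "z \<in> [V - q]\<^bsup>2\<^esup>" for z
    using that h(2)[of z] by (auto simp: g_def Z_def)
  ultimately show ?thesis unfolding berge_clique_def by blast
qed

section \<open>The dichotomy between a red and a blue clique\<close>

text \<open>The removed \<open>q\<close> is the pair that pads all the others to 4-sets; losing it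
  on the blue side is what \<open>s \<le> t - 2\<close> later absorbs.\<close>

lemma red_or_blue_berge_clique:
  fixes V :: "'a set"
  assumes V: "finite V" "card V \<ge> 28" and RB: "R \<union> B = [V]\<^bsup>4\<^esup>"
  shows "berge_clique R V \<or> (\<exists>q\<in>[V]\<^bsup>2\<^esup>. berge_clique B (V - q))"
proof (rule disjCI)
  assume noblue: "\<not> (\<exists>q\<in>[V]\<^bsup>2\<^esup>. berge_clique B (V - q))"
  have B4: "B \<subseteq> [V]\<^bsup>4\<^esup>" and R4: "R \<subseteq> [V]\<^bsup>4\<^esup>" using RB by auto
  have finB: "finite B" and finR: "finite R"
    using B4 R4 V(1) by (meson finite_imp_finite_nsets finite_subset)+
  \<comment> \<open>Five is one below the codegree six that the repair asks for, so exactly the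
    pairs of \<open>P\<close> can obstruct it.\<close>
  define P where "P = {p \<in> [V]\<^bsup>2\<^esup>. card {e \<in> B. p \<subseteq> e} \<le> 5}"
  have P2: "p \<subseteq> V" "finite p" "card p = 2" if "p \<in> P" for p
    using that by (auto simp: P_def nsets_def)
  \<comment> \<open>If \<open>q\<close> has no partner, a pair \<open>z\<close> off \<open>q\<close>
    with \<open>z \<union> q\<close> not blue is not in \<open>P\<close>, so
    \<open>blue_clique_off_pair\<close> yields the excluded clique.\<close>
  have partner: "\<exists>p\<in>P. p \<inter> q = {} \<and> q \<union> p \<in> R" if q: "q \<in> [V]\<^bsup>2\<^esup>" for q
  proof (rule ccontr)
    assume nop: "\<not> ?thesis"
    have "6 \<le> card {e \<in> B. z \<subseteq> e}" if z: "z \<in> [V - q]\<^bsup>2\<^esup>" "z \<union> q \<notin> B" for z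
    proof (rule ccontr)
      assume "\<not> 6 \<le> card {e \<in> B. z \<subseteq> e}"
      then have "z \<in> P" using z by (auto simp: P_def nsets_def)
      moreover have zq: "z \<inter> q = {}" using z by (auto simp: nsets_def)
      moreover have "z \<union> q \<in> [V]\<^bsup>4\<^esup>"
        using z q zq by (auto simp: nsets_def card_Un_disjoint)
      ultimately show False using nop z(2) RB by (metis UnE Un_commute)
    qed
    then have "berge_clique B (V - q)"
      using q by (intro blue_clique_off_pair V(1) B4) (auto simp: nsets_def)
    then show False using noblue q by blast
  qed
  define A where "A = {z \<in> [V]\<^bsup>2\<^esup>. \<forall>p\<in>P. p \<inter> z = {}}"
  define S where "S z = {e \<in> R. \<exists>p\<in>P. e = z \<union> p}" for z
  define X where "X = {z \<in> A. card (S z) = 1}"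
  define F where "F = \<Union>(S ` X)"
  define N where "N z = (if z \<in> A then S z else {e \<in> R. z \<subseteq> e \<and> (\<exists>p\<in>P. p \<subseteq> e)} - F)" for z
  \<comment> \<open>Every edge gets capacity 10: an edge of some \<open>N z\<close> has six pairs, at most one of them in \<open>A\<close>,
    and \<open>5 + 5 \<cdot> 1 = 10\<close>. The edges of \<open>F\<close> are reserved for the pairs of \<open>A\<close> that have only one
    candidate; there are at most ten, as each forms a blue edge with one of two fixed members of \<open>P\<close>.\<close>
  define w where "w z = (if z \<in> X then 10 else if z \<in> A then 5 else 1 :: nat)" for z
  have finS: "finite (S z)" for z using finR by (simp add: S_def)
  have A2: "A \<subseteq> [V]\<^bsup>2\<^esup>" by (auto simp: A_def)
  have finA: "finite A" using A2 V(1) by (meson finite_imp_finite_nsets finite_subset)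
  \<comment> \<open>A pair of \<open>A\<close> inside \<open>e\<close> misses \<open>p\<close>,
    hence is the complement \<open>e - p\<close>. So a 4-set containing a member of \<open>P\<close>
    contains at most one pair of \<open>A\<close>.\<close>
  have A_unique: "z = z'"
    if "z \<in> A" "z' \<in> A" "z \<subseteq> e" "z' \<subseteq> e" "p \<in> P" "p \<subseteq> e" "card e = 4" for z z' e p
  proof -
    have fe: "finite e" using that(7) by (simp add: card_ge_0_finite)
    have *: "y = e - p" if y: "y \<in> A" "y \<subseteq> e" for y
    proof (rule card_subset_eq)
      show "y \<subseteq> e - p" using y \<open>p \<in> P\<close> by (auto simp: A_def)
      have "card (e - p) = 2"
        using \<open>p \<subseteq> e\<close> \<open>card e = 4\<close> P2[OF \<open>p \<in> P\<close>] by (simp add: card_Diff_subset)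
      then show "card y = card (e - p)" using y by (auto simp: A_def nsets_def)
    qed (use fe in simp)
    show ?thesis using *[of z] *[of z'] that by simp
  qed
  have S_unique: "z = z'" if zs: "z \<in> A" "z' \<in> A" "e \<in> S z" "e \<in> S z'" for z z' e
  proof -
    obtain p where p: "p \<in> P" "e = z \<union> p" and eR: "e \<in> R" using zs(3) by (auto simp: S_def)
    have "card e = 4" using eR R4 by (auto simp: nsets_def)
    then show ?thesis using A_unique[of z z' e p] zs p by (auto simp: S_def)
  qed
  have cardX: "card X \<le> 10"
  proof -
    have "\<not> card V < 2" using V(2) by simp
    then obtain q where "q \<in> [V]\<^bsup>2\<^esup>" using nsets_eq_empty_iff[of V 2] by blast
    \<comment> \<open>A partner of an arbitrary pair gives \<open>p1\<close>; a partner of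
      \<open>p1\<close> itself gives a disjoint \<open>p2\<close>.\<close>
    then obtain p1 where p1: "p1 \<in> P" using partner by blast
    then have "p1 \<in> [V]\<^bsup>2\<^esup>" by (simp add: P_def)
    then obtain p2 where p2: "p2 \<in> P" "p2 \<inter> p1 = {}" using partner by blast
    have "p1 \<noteq> p2" using p2 P2[OF p1] by auto
    \<comment> \<open>Distinct \<open>z\<close> in \<open>A\<close> give distinct blue edges
      \<open>z \<union> p\<close> through \<open>p\<close>, and \<open>p\<close> lies in at most
      five.\<close>
    have few: "card {z \<in> A. z \<union> p \<in> B} \<le> 5" if p: "p \<in> P" for p
    proof -
      have "card {z \<in> A. z \<union> p \<in> B} \<le> card {e \<in> B. p \<subseteq> e}"
      proof (rule card_inj_on_le)
        have "z \<inter> p = {}" if "z \<in> A" for z using that p by (auto simp: A_def)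
        then show "inj_on (\<lambda>z. z \<union> p) {z \<in> A. z \<union> p \<in> B}"
          unfolding inj_on_def by blast
      qed (use finB in auto)
      then show ?thesis using p by (simp add: P_def)
    qed
    \<comment> \<open>If neither union were blue, \<open>z \<union> p1\<close> and
      \<open>z \<union> p2\<close> would be two different elements of \<open>S z\<close>.\<close>
    have "X \<subseteq> {z \<in> A. z \<union> p1 \<in> B} \<union> {z \<in> A. z \<union> p2 \<in> B}"
    proof
      fix z assume "z \<in> X"
      then have zA: "z \<in> A" and cS: "card (S z) = 1" by (auto simp: X_def)
      have zp: "z \<union> p \<in> [V]\<^bsup>4\<^esup>" if "p \<in> P" for p
      proof -
        have "z \<inter> p = {}" using zA that by (auto simp: A_def)
        then show ?thesis using zA P2[OF that] by (auto simp: A_def nsets_def card_Un_disjoint)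
      qed
      show "z \<in> {z \<in> A. z \<union> p1 \<in> B} \<union> {z \<in> A. z \<union> p2 \<in> B}"
      proof (rule ccontr)
        assume "\<not> ?thesis"
        then have "z \<union> p1 \<in> S z" "z \<union> p2 \<in> S z"
          using zp[OF p1] zp[OF p2(1)] zA p1 p2(1) RB by (auto simp: S_def)
        then have "z \<union> p1 = z \<union> p2" using cS by (metis card_1_singletonE singletonD)
        moreover have "z \<inter> p1 = {}" "z \<inter> p2 = {}" using zA p1 p2(1) by (auto simp: A_def)
        ultimately show False using \<open>p1 \<noteq> p2\<close> by blast
      qed
    qed
    then have "card X \<le> card ({z \<in> A. z \<union> p1 \<in> B} \<union> {z \<in> A. z \<union> p2 \<in> B})"
      using finA by (intro card_mono) auto
    also have "\<dots> \<le> card {z \<in> A. z \<union> p1 \<in> B} + card {z \<in> A. z \<union> p2 \<in> B}"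
      by (rule card_Un_le)
    finally show ?thesis using few[OF p1] few[OF p2(1)] by simp
  qed
  have finX: "finite X" using finA by (simp add: X_def)
  have cardF: "card F \<le> 10"
  proof -
    have "card F \<le> (\<Sum>z\<in>X. card (S z))" unfolding F_def by (rule card_UN_le[OF finX])
    also have "\<dots> = card X" by (simp add: X_def)
    finally show ?thesis using cardX by simp
  qed
  have finF: "finite F" using finX finS by (simp add: F_def)
  have "\<exists>g. inj_on g ([V]\<^bsup>2\<^esup>) \<and> (\<forall>z\<in>[V]\<^bsup>2\<^esup>. g z \<in> N z)"
  proof (rule weighted_hall[where D = 10 and w = w])
    show "finite ([V]\<^bsup>2\<^esup>)" using V(1) by (rule finite_imp_finite_nsets)
    show "finite (N z)" for z using finR finS by (simp add: N_def)
    show "10 \<le> w z * card (N z)" if z: "z \<in> [V]\<^bsup>2\<^esup>" for z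
    proof (cases "z \<in> A")
      case True
      \<comment> \<open>A partner gives at least one candidate: a single one weighs 10, and two or
        more weigh 5 each.\<close>
      obtain p where "p \<in> P" "z \<union> p \<in> R" using partner[OF z] by blast
      then have "S z \<noteq> {}" by (auto simp: S_def)
      then have "card (S z) \<noteq> 0" using finS by simp
      then show ?thesis using True by (cases "card (S z) = 1") (auto simp: w_def N_def X_def)
    next
      case False
      then obtain p where p: "p \<in> P" "p \<inter> z \<noteq> {}" using z by (auto simp: A_def)
      have "card (p \<union> z) + card (p \<inter> z) = 4"
        using card_Un_Int[of p z] P2[OF p(1)] z by (auto simp: nsets_def)
      moreover have "card (p \<inter> z) \<noteq> 0" using p P2[OF p(1)] by simp
      ultimately have "card (p \<union> z) \<le> 3" by simp
      moreover have "p \<union> z \<subseteq> V" using P2[OF p(1)] z by (auto simp: nsets_def)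
      moreover have "3 \<le> card V" using V(2) by simp
      \<comment> \<open>As \<open>z\<close> meets \<open>p\<close>, their union has at most three
        elements; it is padded because \<open>z\<close> may equal \<open>p\<close>. Each 4-set
        \<open>insert b u\<close> contains both pairs: if red it lies in \<open>N z\<close> or
        \<open>F\<close>, if blue it is one of the few through \<open>p\<close>.\<close>
      ultimately obtain u where u: "p \<union> z \<subseteq> u" "u \<subseteq> V" "card u = 3"
        using exists_subset_between[of "p \<union> z" 3 V] V(1) by blast
      have fu: "finite u" using u(2) V(1) by (rule finite_subset)
      have "card (V - u) = card V - 3" using u fu by (simp add: card_Diff_subset)
      moreover have "card (V - u) \<le> card (N z \<union> {e \<in> B. p \<subseteq> e} \<union> F)"
      proof (rule card_inj_on_le)
        show "inj_on (\<lambda>b. insert b u) (V - u)" by (auto simp: inj_on_def)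
        show "(\<lambda>b. insert b u) ` (V - u) \<subseteq> N z \<union> {e \<in> B. p \<subseteq> e} \<union> F"
        proof (rule image_subsetI)
          fix b assume b: "b \<in> V - u"
          have "insert b u \<in> [V]\<^bsup>4\<^esup>" using b u fu by (auto simp: nsets_def)
          then have "insert b u \<in> R \<union> B" using RB by simp
          then show "insert b u \<in> N z \<union> {e \<in> B. p \<subseteq> e} \<union> F"
            using u(1) p(1) False by (auto simp: N_def)
        qed
        show "finite (N z \<union> {e \<in> B. p \<subseteq> e} \<union> F)" using finB finF finR finS by (simp add: N_def)
      qed
      moreover have "card (N z \<union> {e \<in> B. p \<subseteq> e} \<union> F) \<le> card (N z) + card {e \<in> B. p \<subseteq> e} + card F"
        by (meson add_le_mono1 card_Un_le le_trans)
      moreover have "card {e \<in> B. p \<subseteq> e} \<le> 5" using p(1) by (simp add: P_def)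
      \<comment> \<open>The source of 28: at least 25 extensions of \<open>u\<close>, less at most 5
        blue ones and at most 10 in \<open>F\<close>, leave 10 candidates of weight 1.\<close>
      ultimately have "10 \<le> card (N z)" using V(2) cardF by linarith
      then show ?thesis using False by (simp add: w_def X_def)
    qed
    show "(\<Sum>z\<in>{z \<in> [V]\<^bsup>2\<^esup>. e \<in> N z}. w z) \<le> 10" for e
    proof (cases "e \<in> F")
      case True
      then obtain x where x: "x \<in> X" "e \<in> S x" by (auto simp: F_def)
      \<comment> \<open>Pairs outside \<open>A\<close> have \<open>F\<close> removed from their
        candidates, and \<open>S_unique\<close> leaves only \<open>x\<close> among the pairs of
        \<open>A\<close>.\<close>
      have "{z \<in> [V]\<^bsup>2\<^esup>. e \<in> N z} \<subseteq> {x}"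
        using True x S_unique by (auto simp: N_def X_def split: if_splits)
      then have "(\<Sum>z\<in>{z \<in> [V]\<^bsup>2\<^esup>. e \<in> N z}. w z) \<le> (\<Sum>z\<in>{x}. w z)"
        by (intro sum_mono2) auto
      then show ?thesis using x by (simp add: w_def)
    next
      case eF: False
      define K where "K = {z \<in> [V]\<^bsup>2\<^esup>. e \<in> N z}"
      have finK: "finite K" using V(1) by (simp add: K_def finite_imp_finite_nsets)
      \<comment> \<open>All candidates of pairs in \<open>X\<close> lie in \<open>F\<close>, so
        outside \<open>F\<close> only the weights 5 and 1 occur.\<close>
      have KX: "z \<notin> X" if "z \<in> K" for z
        using that eF by (auto simp: K_def N_def X_def F_def)
      have N_mem: "e \<in> R \<and> z \<subseteq> e \<and> (\<exists>p\<in>P. p \<subseteq> e)" if "z \<in> K" for z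
        using that by (auto simp: K_def N_def S_def split: if_splits)
      have "(\<Sum>z\<in>K. w z) \<le> 10"
      proof (cases "K = {}")
        case True
        then show ?thesis by simp
      next
        case False
        then obtain p where p: "p \<in> P" "p \<subseteq> e" and "e \<in> R" using N_mem by blast
        then have e: "finite e" "card e = 4" using R4 by (auto simp: nsets_def)
        have "K \<subseteq> [e]\<^bsup>2\<^esup>" using N_mem by (auto simp: K_def nsets_def)
        then have K6: "card K \<le> 6"
          using card_mono[OF finite_imp_finite_nsets[OF e(1)]] card_pairs_of_4_set[OF e(2)] by metis
        have KA: "card (K \<inter> A) \<le> 1"
          using card_le_Suc0_iff_eq[of "K \<inter> A"] finK A_unique[OF _ _ _ _ p e(2)] N_mem by auto
        \<comment> \<open>Weight 5 is split as 1 + 4: six pairs at 1 and one extra 4 add up to the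
          capacity.\<close>
        have "(\<Sum>z\<in>K. w z) = (\<Sum>z\<in>K. 1 + (if z \<in> A then 4 else 0))"
          using KX by (intro sum.cong) (auto simp: w_def)
        also have "\<dots> = card K + 4 * card (K \<inter> A)"
          using finK by (simp add: sum.distrib sum.If_cases del: add_Suc)
        finally show ?thesis using K6 KA by simp
      qed
      then show ?thesis by (simp add: K_def)
    qed
  qed simp
  then obtain g where g: "inj_on g ([V]\<^bsup>2\<^esup>)" "\<And>z. z \<in> [V]\<^bsup>2\<^esup> \<Longrightarrow> g z \<in> N z" by blast
  have "g z \<in> R \<and> z \<subseteq> g z" if "z \<in> [V]\<^bsup>2\<^esup>" for z
    using g(2)[OF that] by (auto simp: N_def S_def split: if_splits)
  then show "berge_clique R V" unfolding berge_clique_def using g(1) by blast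
qed

section \<open>Passage between cliques on vertex sets and Berge copies\<close>

lemma contains_Berge_complete_graph:
  fixes H :: "nat hypergraph"
  assumes H: "uniform_hypergraph r H" and C: "C \<subseteq> verts H" "card C = s"
    and clique: "berge_clique (hedges H) C"
  shows "contains_member H (Berge r (complete_graph s) :: nat hypergraph set)"
proof -
  obtain g where g: "inj_on g ([C]\<^bsup>2\<^esup>)" "\<And>z. z \<in> [C]\<^bsup>2\<^esup> \<Longrightarrow> g z \<in> hedges H \<and> z \<subseteq> g z"
    using clique unfolding berge_clique_def by blast
  have "finite C" using C(1) H by (auto simp: uniform_hypergraph_def intro: finite_subset)
  then obtain \<phi> where \<phi>: "bij_betw \<phi> {..<s} C"
    using C(2) by (metis ex_bij_betw_nat_finite atLeast0LessThan)
  \<comment> \<open>All vertices of \<open>H\<close> stay, as chosen edges may leave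
    \<open>C\<close>; the edge set is cut down to the image of \<open>g\<close> so that
    \<open>\<psi>\<close> is onto.\<close>
  define H' where "H' = (verts H, g ` [C]\<^bsup>2\<^esup>)"
  have H4: "hedges H \<subseteq> [verts H]\<^bsup>r\<^esup>" and finV: "finite (verts H)"
    using H by (auto simp: uniform_hypergraph_def)
  have sub: "subhypergraph H' H"
    unfolding subhypergraph_def H'_def fst_conv snd_conv
  proof (intro conjI ballI)
    show "g ` [C]\<^bsup>2\<^esup> \<subseteq> hedges H" using g(2) by blast
    then show "e \<subseteq> verts H" if "e \<in> g ` [C]\<^bsup>2\<^esup>" for e
      using that H4 by (auto simp: nsets_def)
  qed simp
  have iso: "hypergraph_iso H' H'"
    unfolding hypergraph_iso_def by (rule exI[of _ id]) auto
  have bij2: "bij_betw ((`) \<phi>) ([{..<s}]\<^bsup>2\<^esup>) ([C]\<^bsup>2\<^esup>)"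
    using \<phi> by (rule bij_betw_nsets)
  have "H' \<in> Berge r (complete_graph s)"
    unfolding Berge_def mem_Collect_eq
  proof (intro conjI exI[of _ \<phi>] exI[of _ "g \<circ> (`) \<phi>"] allI impI)
    show "uniform_hypergraph r H'"
      using finV H4 g(2) by (auto simp: uniform_hypergraph_def H'_def)
    show "inj_on \<phi> (verts (complete_graph s))" "\<phi> ` verts (complete_graph s) \<subseteq> verts H'"
      using \<phi> C(1) by (auto simp: complete_hypergraph_def H'_def bij_betw_def)
    show "bij_betw (g \<circ> (`) \<phi>) (hedges (complete_graph s)) (hedges H')"
      unfolding complete_hypergraph_def H'_def snd_conv
      by (rule bij_betw_trans[OF bij2]) (use g(1) in \<open>simp add: bij_betw_def\<close>)
    show "{\<phi> u, \<phi> v} \<subseteq> (g \<circ> (`) \<phi>) {u, v}" if "{u, v} \<in> hedges (complete_graph s)" for u v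
    proof -
      have "\<phi> ` {u, v} \<in> [C]\<^bsup>2\<^esup>"
        using that bij2 by (metis bij_betwE complete_hypergraph_def snd_conv)
      then show ?thesis using g(2)[of "\<phi> ` {u, v}"] by simp
    qed
  qed
  then show ?thesis unfolding contains_member_def using sub iso by blast
qed

text \<open>For the lower bound: the core alone occupies \<open>s\<close> distinct vertices, and an
  isomorphism keeps their number.\<close>

lemma contains_Berge_imp_card_le:
  assumes "contains_member H (Berge r (complete_graph s) :: 'b hypergraph set)"
    and "finite (verts H)"
  shows "s \<le> card (verts H)"
proof -
  obtain H' and F :: "'b hypergraph" and \<phi> :: "nat \<Rightarrow> 'b"
    where "subhypergraph H' H" "hypergraph_iso H' F"
      and fin: "finite (verts F)" and \<phi>: "inj_on \<phi> {..<s}" "\<phi> ` {..<s} \<subseteq> verts F"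
    using assms(1)
    unfolding contains_member_def Berge_def uniform_hypergraph_def complete_hypergraph_def
    by fastforce
  then have "card (verts H') = card (verts F)" "verts H' \<subseteq> verts H"
    by (auto simp: hypergraph_iso_def subhypergraph_def bij_betw_same_card)
  moreover have "s \<le> card (verts F)" using card_inj_on_le[OF \<phi> fin] by simp
  ultimately show ?thesis using card_mono[OF assms(2), of "verts H'"] by linarith
qed

text \<open>From \<open>2 \<le> s\<close> the graph has an edge, which \<open>\<psi>\<close> must
  send to some hyperedge; this excludes an absent colour.\<close>

lemma contains_Berge_imp_edges:
  assumes "contains_member H (Berge r (complete_graph s) :: 'b hypergraph set)" and "2 \<le> s"
  shows "hedges H \<noteq> {}"
proof
  assume "hedges H = {}"
  obtain H' and F :: "'b hypergraph" and \<psi>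
    where sub: "subhypergraph H' H" and iso: "hypergraph_iso H' F"
      and \<psi>: "bij_betw \<psi> ([{..<s}]\<^bsup>2\<^esup>) (hedges F)"
    using assms(1)
    unfolding contains_member_def Berge_def complete_hypergraph_def by fastforce
  have "hedges H' = {}" using sub \<open>hedges H = {}\<close> by (simp add: subhypergraph_def)
  then have "hedges F = {}" using iso by (auto simp: hypergraph_iso_def)
  then have "[{..<s}]\<^bsup>2\<^esup> = {}" using \<psi> by (simp add: bij_betw_def)
  then show False using assms(2) by (simp add: nsets_eq_empty_iff)
qed

section \<open>The value of the Ramsey number\<close>

theorem theorem2p12:
  fixes s t :: nat
  assumes "2 \<le> s" and "s \<le> t - 2" and "t \<ge> 34"
  shows "ramsey_number 4 (Berge 4 (complete_graph t) :: nat hypergraph set)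
                         (Berge 4 (complete_graph s) :: nat hypergraph set) = t"
  unfolding ramsey_number_def
proof (rule Least_equality)
  let ?V = "{..<t}"
  show "ramsey_property 4 (Berge 4 (complete_graph t) :: nat hypergraph set)
          (Berge 4 (complete_graph s) :: nat hypergraph set) t"
    unfolding ramsey_property_def
  proof
    fix c assume c: "c \<in> hedges (complete_hypergraph 4 t) \<rightarrow> {1, 2::nat}"
    let ?H = "\<lambda>i. color_class (complete_hypergraph 4 t) c i"
    have verts: "verts (?H i) = ?V" for i by (simp add: color_class_def complete_hypergraph_def)
    have unif: "uniform_hypergraph 4 (?H i)" for i
      by (auto simp: uniform_hypergraph_def color_class_def complete_hypergraph_def)
    have "hedges (?H 1) \<union> hedges (?H 2) = [?V]\<^bsup>4\<^esup>"
      using c by (auto simp: color_class_def complete_hypergraph_def)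
    \<comment> \<open>Red is colour 1 and blue is colour 2.\<close>
    then have "berge_clique (hedges (?H 1)) ?V \<or>
        (\<exists>q\<in>[?V]\<^bsup>2\<^esup>. berge_clique (hedges (?H 2)) (?V - q))"
      using assms(3) by (intro red_or_blue_berge_clique) auto
    then consider "berge_clique (hedges (?H 1)) ?V"
      | q where "q \<in> [?V]\<^bsup>2\<^esup>" "berge_clique (hedges (?H 2)) (?V - q)"
      by blast
    then show "contains_member (?H 1) (Berge 4 (complete_graph t) :: nat hypergraph set) \<or>
               contains_member (?H 2) (Berge 4 (complete_graph s) :: nat hypergraph set)"
    proof cases
      case 1
      then show ?thesis
        by (intro disjI1 contains_Berge_complete_graph[of _ _ ?V] unif) (auto simp: verts)
    next
      case 2
      have "card (?V - q) = t - 2"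
        using 2(1) by (auto simp: nsets_def card_Diff_subset)
      \<comment> \<open>The blue core has \<open>t - 2\<close> vertices, and any \<open>s\<close> of
        them still form a core.\<close>
      then obtain C where C: "C \<subseteq> ?V - q" "card C = s"
        using assms(2) by (metis obtain_subset_with_card_n)
      then show ?thesis
        using 2(2) by (intro disjI2 contains_Berge_complete_graph[of _ _ C] unif)
          (auto simp: verts intro: berge_clique_mono)
    qed
  qed
next
  fix N
  assume ramsey: "ramsey_property 4 (Berge 4 (complete_graph t) :: nat hypergraph set)
                  (Berge 4 (complete_graph s) :: nat hypergraph set) N"
  \<comment> \<open>The lower bound uses the constant colouring 1: colour 2 has no edge at all, so
    colour 1 must contain the copy for \<open>t\<close> within \<open>N\<close> vertices.\<close>
  let ?H = "\<lambda>i. color_class (complete_hypergraph 4 N) (\<lambda>_. 1) i"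
  have "hedges (?H 2) = {}" by (simp add: color_class_def)
  then have "\<not> contains_member (?H 2) (Berge 4 (complete_graph s) :: nat hypergraph set)"
    using contains_Berge_imp_edges assms(1) by blast
  moreover have "(\<lambda>_. 1) \<in> hedges (complete_hypergraph 4 N) \<rightarrow> {1, 2::nat}" by simp
  ultimately have "contains_member (?H 1) (Berge 4 (complete_graph t) :: nat hypergraph set)"
    using ramsey unfolding ramsey_property_def by blast
  from contains_Berge_imp_card_le[OF this] show "t \<le> N"
    by (simp add: color_class_def complete_hypergraph_def)
qed

end
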